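(* Let $\Gamma$ be a finite, connected, simple, undirected graph with at least one edge and vertex set $V_\Gamma=\{v_1,\dots,v_n\}$, let $G$ be a group, let $s\in Z(G)$ with $s^2=1_G$, and let $\psi_1,\psi_2$ be $G$-gain functions on $\Gamma$. The following are equivalent: (1) $\psi_1$ and $\psi_2$ are switching equivalent; (2) $A_{\Gamma,\psi_1}\sim A_{\Gamma,\psi_2}$; (3) $\Delta^{s}_{\Gamma,\psi_1}\sim \Delta^{s}_{\Gamma,\psi_2}$.
   Context: $\mathbb CG$ is the complex group algebra of $G$ (finite formal sums $\sum_{x\in G} f_x x$, $f_x\in\mathbb C$), with multiplication extending that of $G$ and involution $(\sum f_x x)^*=\sum \overline{f_x}\,x^{-1}$; $G$ is regarded as a subset of $\mathbb CG$ and $0$ denotes the zero of $\mathbb CG$. $M_n(\mathbb CG)$ is the algebra of $n\times n$ matrices over $\mathbb CG$ with the usual matrix product and $(A^* )_{i,j}=(A_{j,i})^*$. A $G$-gain function on $\Gamma$ is a map $\psi$ from the set of ordered pairs $(u,v)$ of adjacent vertices to $G$ with $\psi(v,u)=\psi(u,v)^{-1}$. Two gain functions $\psi_1,\psi_2$ are switching equivalent if there is $f\colon V_\Gamma\to G$ with $\psi_2(v_i,v_j)=f(v_i)^{-1}\psi_1(v_i,v_j)f(v_j)$ for all adjacent $v_i,v_j$. The adjacency matrix $A_{\Gamma,\psi}\in M_n(\mathbb CG)$ has $(i,j)$ entry $\psi(v_i,v_j)$ if $v_i\sim v_j$ and $0$ otherwise. The $s$-Laplacian is $\Delta^s_{\Gamma,\psi}=\deg(\Gamma,G)+sA_{\Gamma,\psi}$,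 where $\deg(\Gamma,G)=\mathrm{diag}(\deg(v_1)1_G,\dots,\deg(v_n)1_G)$ and $sA$ means multiplying each entry on the left by $s$. For $A,B\in M_n(\mathbb CG)$, $A\sim B$ means there is a diagonal $F\in M_n(\mathbb CG)$ with all diagonal entries in $G$ such that $F^*AF=B$. *)

theory Defs
  imports Complex_Main "HOL-Library.Poly_Mapping" "Jordan_Normal_Form.Matrix"
    "Graph_Theory.Graph_Theory"
begin

text \<open>
  The group \<open>G\<close> is the universe of a type of class \<^class>\<open>group_add\<close>. This class does not assume
  commutativity; the group operation, unit and inverse are only written \<open>+\<close>, \<open>0\<close> and \<open>-\<close>.
  With this notation, \<open>'g \<Rightarrow>\<^sub>0 complex\<close> with the convolution product of \<^theory>\<open>HOL-Library.Poly_Mapping\<close>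
  is the group algebra of \<open>G\<close>.
\<close>

type_synonym 'g group_algebra = "'g \<Rightarrow>\<^sub>0 complex"

abbreviation group_elt :: "'g \<Rightarrow> 'g group_algebra" where
  "group_elt g \<equiv> Poly_Mapping.single g 1"

definition center :: "'g::group_add set" where
  "center = {s. \<forall>g. s + g = g + s}"

definition star :: "'g::group_add group_algebra \<Rightarrow> 'g group_algebra" where
  "star f = (\<Sum>x\<in>Poly_Mapping.keys f. Poly_Mapping.single (- x) (cnj (Poly_Mapping.lookup f x)))"

definition mat_star :: "'g::group_add group_algebra mat \<Rightarrow> 'g group_algebra mat" where
  "mat_star A = mat (dim_col A) (dim_row A) (\<lambda>(i, j). star (A $$ (j, i)))"

definition diag_similar ::
  "nat \<Rightarrow> 'g::group_add group_algebra mat \<Rightarrow> 'g group_algebra mat \<Rightarrow> bool" where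
  "diag_similar n A B \<longleftrightarrow>
     (\<exists>F \<in> carrier_mat n n. diagonal_mat F \<and> (\<forall>i<n. F $$ (i, i) \<in> range group_elt) \<and>
        mat_star F * A * F = B)"

text \<open>
  Simple undirected graphs are the symmetric loopfree digraphs \<^locale>\<open>pair_graph\<close>: the arcs are the
  ordered pairs of adjacent vertices. A gain function is represented by a total function, whose
  values on non-adjacent pairs are irrelevant.
\<close>

definition gain_function :: "'v pair_pre_digraph \<Rightarrow> ('v \<Rightarrow> 'v \<Rightarrow> 'g::group_add) \<Rightarrow> bool" where
  "gain_function \<Gamma> \<psi> \<longleftrightarrow> (\<forall>u w. (u, w) \<in> parcs \<Gamma> \<longrightarrow> \<psi> w u = - \<psi> u w)"

definition switching_equivalent ::
  "'v pair_pre_digraph \<Rightarrow> ('v \<Rightarrow> 'v \<Rightarrow> 'g::group_add) \<Rightarrow> ('v \<Rightarrow> 'v \<Rightarrow> 'g) \<Rightarrow> bool" where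
  "switching_equivalent \<Gamma> \<psi>\<^sub>1 \<psi>\<^sub>2 \<longleftrightarrow>
     (\<exists>f. \<forall>u w. (u, w) \<in> parcs \<Gamma> \<longrightarrow> \<psi>\<^sub>2 u w = - f u + \<psi>\<^sub>1 u w + f w)"

text \<open>
  In the following, \<open>v 0, \<dots>, v (n - 1)\<close> is the enumeration of the vertices that indexes rows and
  columns. As every edge appears as two opposite arcs, the degree of a vertex is its out-degree.
\<close>

definition adjacency_mat ::
  "'v pair_pre_digraph \<Rightarrow> nat \<Rightarrow> (nat \<Rightarrow> 'v) \<Rightarrow> ('v \<Rightarrow> 'v \<Rightarrow> 'g::group_add) \<Rightarrow> 'g group_algebra mat" where
  "adjacency_mat \<Gamma> n v \<psi> =
     mat n n (\<lambda>(i, j). if (v i, v j) \<in> parcs \<Gamma> then group_elt (\<psi> (v i) (v j)) else 0)"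

definition degree_mat ::
  "'v pair_pre_digraph \<Rightarrow> nat \<Rightarrow> (nat \<Rightarrow> 'v) \<Rightarrow> 'g::group_add group_algebra mat" where
  "degree_mat \<Gamma> n v =
     mat n n (\<lambda>(i, j). if i = j
       then Poly_Mapping.single 0 (of_nat (out_degree (with_proj \<Gamma>) (v i))) else 0)"

definition laplacian_mat ::
  "'g::group_add \<Rightarrow> 'v pair_pre_digraph \<Rightarrow> nat \<Rightarrow> (nat \<Rightarrow> 'v) \<Rightarrow> ('v \<Rightarrow> 'v \<Rightarrow> 'g) \<Rightarrow> 'g group_algebra mat" where
  "laplacian_mat s \<Gamma> n v \<psi> = degree_mat \<Gamma> n v + group_elt s \<cdot>\<^sub>m adjacency_mat \<Gamma> n v \<psi>"

end

theory Submission
  imports Defs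
begin

text \<open>Each of the three conditions unwinds to the same one: there are group elements
  \<open>f i\<close>, indexed by the rows, with \<open>\<psi>\<^sub>2 (v i) (v j) = - f i +
  \<psi>\<^sub>1 (v i) (v j) + f j\<close> on every arc. A diagonal F with entries
  \<open>f i\<close> in G has F^* = F^{-1}, so F^*AF multiplies the (i,j) entry by the inverse of
  \<open>f i\<close> on the left and by \<open>f j\<close> on the right
  (\<open>diag_similar_iff\<close>). For adjacency matrices the entries are 0 or group elements, and
  G embeds in the group algebra, so equality of entries is the switching relation
  (\<open>diag_similar_adjacency_mat_iff\<close>). In the Laplacian, the diagonal entries are
  multiples of the unit and are fixed by conjugation, while the central factor s cancels off the
  diagonal (\<open>diag_similar_laplacian_mat_iff\<close>). The enumeration of the vertices turns
  functions on indices into functions on vertices and back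
  (\<open>switching_equivalent_iff\<close>).\<close>

lemma star_zero: "star 0 = 0"
  by (simp add: star_def)

lemma star_group_elt: "star (group_elt g) = group_elt (- g)"
  by (simp add: star_def)

lemma group_elt_eq_iff: "group_elt g = group_elt h \<longleftrightarrow> g = h"
  by (metis lookup_single_eq lookup_single_not_eq zero_neq_one)

lemma diagonal_mat_eq_mat_diag:
  assumes "F \<in> carrier_mat n n" "diagonal_mat F" "\<And>i. i < n \<Longrightarrow> F $$ (i, i) = d i"
  shows "F = mat_diag n d"
  using assms by (intro eq_matI) (auto simp: mat_diag_def diagonal_mat_def)

lemma mat_star_mat_diag: "mat_star (mat_diag n d) = mat_diag n (\<lambda>i. star (d i))"
  by (intro eq_matI) (auto simp: mat_star_def mat_diag_def star_zero)

text \<open>Reduces similarity to entrywise equations in the group algebra, so that no matrix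
  product has to be handled afterwards.\<close>

lemma diag_similar_iff:
  fixes A B :: "'g::group_add group_algebra mat"
  assumes A: "A \<in> carrier_mat n n" and B: "B \<in> carrier_mat n n"
  shows "diag_similar n A B \<longleftrightarrow>
    (\<exists>f. \<forall>i<n. \<forall>j<n. group_elt (- f i) * A $$ (i, j) * group_elt (f j) = B $$ (i, j))"
proof -
  have conj: "mat_star (mat_diag n (\<lambda>i. group_elt (f i))) * A * mat_diag n (\<lambda>i. group_elt (f i)) =
      mat n n (\<lambda>(i, j). group_elt (- f i) * A $$ (i, j) * group_elt (f j))" for f :: "nat \<Rightarrow> 'g"
    unfolding mat_star_mat_diag star_group_elt mat_diag_mult_left[OF A]
    by (subst mat_diag_mult_right[of _ n n]) (simp, rule eq_matI, simp_all)
  have "diag_similar n A B \<longleftrightarrow>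
      (\<exists>f. mat_star (mat_diag n (\<lambda>i. group_elt (f i))) * A * mat_diag n (\<lambda>i. group_elt (f i)) = B)"
  proof
    assume "diag_similar n A B"
    then obtain F where F: "F \<in> carrier_mat n n" "diagonal_mat F"
        "\<forall>i<n. F $$ (i, i) \<in> range group_elt" "mat_star F * A * F = B"
      by (auto simp: diag_similar_def)
    \<comment> \<open>The guard \<open>i < n\<close> sits inside the existential so that
      \<open>choice\<close> yields a total function, arbitrary beyond the matrix.\<close>
    have "\<forall>i. \<exists>g. i < n \<longrightarrow> F $$ (i, i) = group_elt g"
      using F(3) by auto
    from choice[OF this] obtain f where f: "\<And>i. i < n \<Longrightarrow> F $$ (i, i) = group_elt (f i)"
      by blast
    have "F = mat_diag n (\<lambda>i. group_elt (f i))"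
      using F(1,2) f by (rule diagonal_mat_eq_mat_diag)
    with F(4) show "\<exists>f. mat_star (mat_diag n (\<lambda>i. group_elt (f i))) * A *
        mat_diag n (\<lambda>i. group_elt (f i)) = B"
      by blast
  next
    assume "\<exists>f. mat_star (mat_diag n (\<lambda>i. group_elt (f i))) * A *
      mat_diag n (\<lambda>i. group_elt (f i)) = B"
    then obtain f where f: "mat_star (mat_diag n (\<lambda>i. group_elt (f i))) * A *
        mat_diag n (\<lambda>i. group_elt (f i)) = B" ..
    show "diag_similar n A B"
      unfolding diag_similar_def
    proof (intro bexI conjI)
      show "diagonal_mat (mat_diag n (\<lambda>i. group_elt (f i)))"
        by (simp add: diagonal_mat_def mat_diag_def)
      show "\<forall>i<n. mat_diag n (\<lambda>i. group_elt (f i)) $$ (i, i) \<in> range group_elt"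
        by (simp add: mat_diag_def)
    qed (fact f, simp)
  qed
  also have "\<dots> \<longleftrightarrow>
      (\<exists>f. \<forall>i<n. \<forall>j<n. group_elt (- f i) * A $$ (i, j) * group_elt (f j) = B $$ (i, j))"
    unfolding conj using B by (simp add: mat_eq_iff)
  finally show ?thesis .
qed

lemma diag_similar_adjacency_mat_iff:
  fixes \<psi>\<^sub>1 \<psi>\<^sub>2 :: "'v \<Rightarrow> 'v \<Rightarrow> 'g::group_add"
  shows "diag_similar n (adjacency_mat \<Gamma> n v \<psi>\<^sub>1) (adjacency_mat \<Gamma> n v \<psi>\<^sub>2) \<longleftrightarrow>
    (\<exists>f. \<forall>i<n. \<forall>j<n. (v i, v j) \<in> parcs \<Gamma> \<longrightarrow>
      \<psi>\<^sub>2 (v i) (v j) = - f i + \<psi>\<^sub>1 (v i) (v j) + f j)"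
proof -
  \<comment> \<open>For non-adjacent vertices both sides are 0 and the implication is vacuous; for
    adjacent ones, compare two basis elements of the group algebra.\<close>
  have entry: "group_elt (- f i) * adjacency_mat \<Gamma> n v \<psi>\<^sub>1 $$ (i, j) * group_elt (f j) =
      adjacency_mat \<Gamma> n v \<psi>\<^sub>2 $$ (i, j) \<longleftrightarrow>
    ((v i, v j) \<in> parcs \<Gamma> \<longrightarrow> \<psi>\<^sub>2 (v i) (v j) = - f i + \<psi>\<^sub>1 (v i) (v j) + f j)"
    if "i < n" "j < n" for f i j
    using that by (simp add: adjacency_mat_def mult_single group_elt_eq_iff) metis
  have carrier: "adjacency_mat \<Gamma> n v \<psi> \<in> carrier_mat n n" for \<psi> :: "'v \<Rightarrow> 'v \<Rightarrow> 'g"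
    by (simp add: adjacency_mat_def)
  show ?thesis
    by (simp add: diag_similar_iff[OF carrier carrier] entry)
qed

lemma diag_similar_laplacian_mat_iff:
  fixes \<psi>\<^sub>1 \<psi>\<^sub>2 :: "'v \<Rightarrow> 'v \<Rightarrow> 'g::group_add"
  assumes loopfree: "\<And>u. (u, u) \<notin> parcs \<Gamma>" and s: "s \<in> center"
  shows "diag_similar n (laplacian_mat s \<Gamma> n v \<psi>\<^sub>1) (laplacian_mat s \<Gamma> n v \<psi>\<^sub>2) \<longleftrightarrow>
    (\<exists>f. \<forall>i<n. \<forall>j<n. (v i, v j) \<in> parcs \<Gamma> \<longrightarrow>
      \<psi>\<^sub>2 (v i) (v j) = - f i + \<psi>\<^sub>1 (v i) (v j) + f j)"
proof -
  \<comment> \<open>Centrality moves s to the front, where it cancels on the left.\<close>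
  have central: "- a + (s + b) + c = s + d \<longleftrightarrow> d = - a + b + c" for a b c d
  proof -
    have "- a + (s + b) + c = s + (- a + b + c)"
      using s by (simp add: center_def) (metis add.assoc)
    then show ?thesis by auto
  qed
  have entry: "group_elt (- f i) * laplacian_mat s \<Gamma> n v \<psi>\<^sub>1 $$ (i, j) * group_elt (f j) =
      laplacian_mat s \<Gamma> n v \<psi>\<^sub>2 $$ (i, j) \<longleftrightarrow>
    ((v i, v j) \<in> parcs \<Gamma> \<longrightarrow> \<psi>\<^sub>2 (v i) (v j) = - f i + \<psi>\<^sub>1 (v i) (v j) + f j)"
    if "i < n" "j < n" for f i j
    \<comment> \<open>If i = j, there is no loop, so only the degree remains, and conjugating a
      multiple of the unit by \<open>f i\<close> fixes it. Otherwise only the adjacency term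
      remains. Removing \<open>single_of_nat\<close> keeps the degree in the form
      \<open>single 0 _\<close>, to which \<open>mult_single\<close> applies.\<close>
    using that loopfree
    by (cases "i = j")
      (auto simp: laplacian_mat_def degree_mat_def adjacency_mat_def mult_single
        group_elt_eq_iff central simp del: single_of_nat)
  have carrier: "laplacian_mat s \<Gamma> n v \<psi> \<in> carrier_mat n n" for \<psi> :: "'v \<Rightarrow> 'v \<Rightarrow> 'g"
    by (simp add: laplacian_mat_def degree_mat_def adjacency_mat_def)
  show ?thesis
    by (simp add: diag_similar_iff[OF carrier carrier] entry)
qed

text \<open>Transport along the bijection \<open>v\<close>: compose a function on vertices with
  \<open>v\<close>, or a function on indices with its inverse.\<close>

lemma switching_equivalent_iff:
  assumes arcs: "parcs \<Gamma> \<subseteq> pverts \<Gamma> \<times> pverts \<Gamma>" and v: "bij_betw v {..<n} (pverts \<Gamma>)"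
  shows "switching_equivalent \<Gamma> \<psi>\<^sub>1 \<psi>\<^sub>2 \<longleftrightarrow>
    (\<exists>f. \<forall>i<n. \<forall>j<n. (v i, v j) \<in> parcs \<Gamma> \<longrightarrow>
      \<psi>\<^sub>2 (v i) (v j) = - f i + \<psi>\<^sub>1 (v i) (v j) + f j)"
proof
  assume "switching_equivalent \<Gamma> \<psi>\<^sub>1 \<psi>\<^sub>2"
  then obtain f where "\<forall>u w. (u, w) \<in> parcs \<Gamma> \<longrightarrow> \<psi>\<^sub>2 u w = - f u + \<psi>\<^sub>1 u w + f w"
    by (auto simp: switching_equivalent_def)
  then show "\<exists>f. \<forall>i<n. \<forall>j<n. (v i, v j) \<in> parcs \<Gamma> \<longrightarrow>
      \<psi>\<^sub>2 (v i) (v j) = - f i + \<psi>\<^sub>1 (v i) (v j) + f j"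
    by (intro exI[of _ "\<lambda>i. f (v i)"]) simp
next
  assume "\<exists>f. \<forall>i<n. \<forall>j<n. (v i, v j) \<in> parcs \<Gamma> \<longrightarrow>
    \<psi>\<^sub>2 (v i) (v j) = - f i + \<psi>\<^sub>1 (v i) (v j) + f j"
  then obtain f where f: "\<And>i j. i < n \<Longrightarrow> j < n \<Longrightarrow> (v i, v j) \<in> parcs \<Gamma> \<Longrightarrow>
      \<psi>\<^sub>2 (v i) (v j) = - f i + \<psi>\<^sub>1 (v i) (v j) + f j"
    by blast
  let ?idx = "inv_into {..<n} v"
  have idx: "?idx u < n" "v (?idx u) = u" if "u \<in> pverts \<Gamma>" for u
    using that bij_betw_inv_into_right[OF v] bij_betwE[OF bij_betw_inv_into[OF v]] by auto
  \<comment> \<open>The inverse is meaningful only on vertices, hence the appeal to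
    \<open>arcs\<close> for both endpoints.\<close>
  have "\<psi>\<^sub>2 u w = - f (?idx u) + \<psi>\<^sub>1 u w + f (?idx w)" if "(u, w) \<in> parcs \<Gamma>" for u w
    using f[of "?idx u" "?idx w"] idx[of u] idx[of w] that arcs by auto
  then show "switching_equivalent \<Gamma> \<psi>\<^sub>1 \<psi>\<^sub>2"
    by (auto simp: switching_equivalent_def intro!: exI[of _ "\<lambda>u. f (?idx u)"])
qed

theorem theorem3p5:
  fixes \<Gamma> :: "'v pair_pre_digraph" and n :: nat and v :: "nat \<Rightarrow> 'v"
    and s :: "'g::group_add" and \<psi>\<^sub>1 \<psi>\<^sub>2 :: "'v \<Rightarrow> 'v \<Rightarrow> 'g"
  assumes "pair_graph \<Gamma>"
    and "Digraph_Component.connected (with_proj \<Gamma>)"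
    and "parcs \<Gamma> \<noteq> {}"
    and "bij_betw v {..<n} (pverts \<Gamma>)"
    and "s \<in> center" and "s + s = 0"
    and "gain_function \<Gamma> \<psi>\<^sub>1" and "gain_function \<Gamma> \<psi>\<^sub>2"
  shows "(switching_equivalent \<Gamma> \<psi>\<^sub>1 \<psi>\<^sub>2 \<longleftrightarrow>
           diag_similar n (adjacency_mat \<Gamma> n v \<psi>\<^sub>1) (adjacency_mat \<Gamma> n v \<psi>\<^sub>2)) \<and>
         (diag_similar n (adjacency_mat \<Gamma> n v \<psi>\<^sub>1) (adjacency_mat \<Gamma> n v \<psi>\<^sub>2) \<longleftrightarrow>
           diag_similar n (laplacian_mat s \<Gamma> n v \<psi>\<^sub>1) (laplacian_mat s \<Gamma> n v \<psi>\<^sub>2))"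
proof -
  interpret pair_graph \<Gamma> by fact
  have arcs: "parcs \<Gamma> \<subseteq> pverts \<Gamma> \<times> pverts \<Gamma>"
    using in_arcsD1 in_arcsD2 by auto
  have loopfree: "(u, u) \<notin> parcs \<Gamma>" for u
    using pair_no_loops[of "(u, u)"] by auto
  \<comment> \<open>After rewriting, all three conditions are literally the same formula.\<close>
  show ?thesis
    unfolding switching_equivalent_iff[OF arcs assms(4)] diag_similar_adjacency_mat_iff
      diag_similar_laplacian_mat_iff[OF loopfree assms(5)]
    by (rule conjI; rule refl)
qed

end
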